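(* Let $\mathcal{A}$ be an algebra (with finite signature) whose universe has exactly two elements. Then $\mathcal{A}$ is not primal if and only if $\mathrm{Prim}(\mathcal{A})\leq\frac{1}{2}$.
   Context: All algebras are algebras in the sense of universal algebra, finite and with a finite signature. Let $A$ be the universe of $\mathcal{A}$. An algebra is primal if every operation $A^k\to A$ of positive arity $k$ is (the interpretation of) a term of the algebra. For $k\geq 1$ and $f,g:A^k\to A$ the coincidence ratio is $$\mu(f,g)=\frac{|\{\vec{x}\in A^k\mid f(\vec{x})=g(\vec{x})\}|}{|A|^k}.$$ $\mathrm{Clo}(\mathcal{A})$ is the clone generated by the operations of $\mathcal{A}$, i.e. the term functions (it contains all projections), $\mathrm{Clo}_k(\mathcal{A})$ is the set of its $k$-ary members, and $\mathcal{F}_k(\mathcal{A})$ is the set of all functions $A^k\to A$. The arity-$k$ primality is $$\mathrm{Prim}_k(\mathcal{A})=\min_{f\in\mathcal{F}_k(\mathcal{A})}\ \max_{t\in\mathrm{Clo}_k(\mathcal{A})}\mu(f,t),$$ and the primality is $\mathrm{Prim}(\mathcal{A})=\inf_{k\geq1}\mathrm{Prim}_k(\mathcal{A})$. *)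

theory Defs
  imports Complex_Main "HOL-Library.FuncSet"
begin

record ('s, 'a) algebra =
  universe :: "'a set"
  symbols :: "'s set"
  arity :: "'s \<Rightarrow> nat"
  interp :: "'s \<Rightarrow> 'a list \<Rightarrow> 'a"

definition tuples :: "nat \<Rightarrow> 'a set \<Rightarrow> 'a list set" where
  "tuples k A = {xs. set xs \<subseteq> A \<and> length xs = k}"

text \<open>Nullary operations (constants) are allowed in the signature.\<close>

definition finite_algebra :: "('s, 'a) algebra \<Rightarrow> bool" where
  "finite_algebra \<A> \<longleftrightarrow>
     finite (universe \<A>) \<and> universe \<A> \<noteq> {} \<and> finite (symbols \<A>) \<and>
     (\<forall>s\<in>symbols \<A>. \<forall>xs\<in>tuples (arity \<A> s) (universe \<A>). interp \<A> s xs \<in> universe \<A>)"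

text \<open>The operations \<open>A^k \<rightarrow> A\<close>, made extensional (\<open>undefined\<close> off \<open>A^k\<close>), so that
  there are exactly \<open>|A| ^ (|A| ^ k)\<close> of them.\<close>

definition all_functions :: "('s, 'a) algebra \<Rightarrow> nat \<Rightarrow> ('a list \<Rightarrow> 'a) set" where
  "all_functions \<A> k = tuples k (universe \<A>) \<rightarrow>\<^sub>E universe \<A>"

datatype 's op_term = Var nat | App 's "'s op_term list"

text \<open>Terms over the signature in the variables \<open>0, \<dots>, k - 1\<close>.\<close>

fun is_term :: "('s, 'a) algebra \<Rightarrow> nat \<Rightarrow> 's op_term \<Rightarrow> bool" where
  "is_term \<A> k (Var i) \<longleftrightarrow> i < k"
| "is_term \<A> k (App s ts) \<longleftrightarrow>
     s \<in> symbols \<A> \<and> length ts = arity \<A> s \<and> (\<forall>t\<in>set ts. is_term \<A> k t)"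

fun eval_term :: "('s, 'a) algebra \<Rightarrow> 's op_term \<Rightarrow> 'a list \<Rightarrow> 'a" where
  "eval_term \<A> (Var i) xs = xs ! i"
| "eval_term \<A> (App s ts) xs = interp \<A> s (map (\<lambda>t. eval_term \<A> t xs) ts)"

definition Clo :: "('s, 'a) algebra \<Rightarrow> nat \<Rightarrow> ('a list \<Rightarrow> 'a) set" where
  "Clo \<A> k = {restrict (eval_term \<A> t) (tuples k (universe \<A>)) | t. is_term \<A> k t}"

definition primal :: "('s, 'a) algebra \<Rightarrow> bool" where
  "primal \<A> \<longleftrightarrow> (\<forall>k\<ge>1. \<forall>f\<in>all_functions \<A> k. f \<in> Clo \<A> k)"

definition coincidence :: "'a set \<Rightarrow> nat \<Rightarrow> ('a list \<Rightarrow> 'a) \<Rightarrow> ('a list \<Rightarrow> 'a) \<Rightarrow> real" where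
  "coincidence A k f g = real (card {xs \<in> tuples k A. f xs = g xs}) / real (card A ^ k)"

text \<open>For a finite algebra and \<open>k \<ge> 1\<close> the sets under \<open>Min\<close> and \<open>Max\<close> are finite and
  nonempty, since \<open>Clo \<A> k\<close> is a subset of \<open>all_functions \<A> k\<close> and contains the
  projections.\<close>

definition Prim_arity :: "nat \<Rightarrow> ('s, 'a) algebra \<Rightarrow> real" where
  "Prim_arity k \<A> =
     Min ((\<lambda>f. Max ((\<lambda>t. coincidence (universe \<A>) k f t) ` Clo \<A> k)) ` all_functions \<A> k)"

definition Prim :: "('s, 'a) algebra \<Rightarrow> real" where
  "Prim \<A> = (INF k\<in>{1..}. Prim_arity k \<A>)"

end

theory Submission imports Defs begin

text \<open>
  If the algebra is primal, every operation coincides with a term, so \<open>Prim\<close> is at least \<open>1\<close>.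
  The content is in the converse, for which the unary term operations already decide almost
  everything.

  If some \<open>g : A \<rightarrow> A\<close> is not a unary term operation, then \<open>g\<close> differs from every unary term
  operation in at least one of the only two points, so the arity-\<open>1\<close> primality is at most \<open>1/2\<close>.

  Otherwise both constants and the negation are term operations. Identify \<open>A\<close> with the field of two
  elements. If some basic operation is not affine, then substituting constants and (possibly negated)
  variables into it yields a binary operation with an odd number of ones
  (\<open>odd_binary_from_non_affine\<close>), and this is conjunction up to negations of inputs and output
  (\<open>conj_from_odd\<close>). Conjunction, negation and constants generate everything
  (\<open>term_op_of_conj\<close>), so the algebra is primal.

  If all basic operations are affine, then so are all terms. The inner product
  \<open>x\<^sub>1 x\<^sub>2 + \<dots> + x\<^bsub>2n-1\<^esub> x\<^bsub>2n\<^esub>\<close> is a bent function: its correlation with every affine operation is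
  only \<open>2^n\<close> on a space of \<open>4^n\<close> points (\<open>bent_correlation\<close>). So the primality of arity \<open>2n\<close> is at
  most \<open>1/2 + 1/2^(n+1)\<close>, and the infimum over \<open>n\<close> is at most \<open>1/2\<close>. No single arity need reach
  \<open>1/2\<close> in this case.
\<close>

section \<open>Tuples and coincidence ratios\<close>

lemma finite_tuples: "finite A \<Longrightarrow> finite (tuples k A)"
  unfolding tuples_def by (rule finite_lists_length_eq)

lemma card_tuples: "finite A \<Longrightarrow> card (tuples k A) = card A ^ k"
  unfolding tuples_def by (rule card_lists_length_eq)

lemma tuples_0 [simp]: "tuples 0 A = {[]}"
  by (auto simp: tuples_def)

lemma Cons_in_tuples [simp]: "a # xs \<in> tuples (Suc k) A \<longleftrightarrow> a \<in> A \<and> xs \<in> tuples k A"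
  by (auto simp: tuples_def)

lemma nth_tuples: "xs \<in> tuples k A \<Longrightarrow> i < k \<Longrightarrow> xs ! i \<in> A"
  by (auto simp: tuples_def)

lemma sum_tuples_Suc:
  "(\<Sum>xs\<in>tuples (Suc k) A. \<phi> xs) = (\<Sum>a\<in>A. \<Sum>xs\<in>tuples k A. \<phi> (a # xs))"
proof -
  have "tuples (Suc k) A = (\<lambda>(a, xs). a # xs) ` (A \<times> tuples k A)"
    by (auto simp: tuples_def length_Suc_conv image_iff)
  moreover have "inj_on (\<lambda>(a, xs). a # xs) (A \<times> tuples k A)"
    by (auto simp: inj_on_def)
  ultimately show ?thesis
    by (simp add: sum.reindex sum.cartesian_product case_prod_unfold)
qed

lemma eval_term_closed:
  assumes "finite_algebra \<A>" and "xs \<in> tuples k (universe \<A>)"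
  shows "is_term \<A> k t \<Longrightarrow> eval_term \<A> t xs \<in> universe \<A>"
proof (induction t)
  case (Var i)
  then show ?case using assms by (simp add: nth_tuples)
next
  case (App s ts)
  then have "map (\<lambda>t. eval_term \<A> t xs) ts \<in> tuples (arity \<A> s) (universe \<A>)"
    by (auto simp: tuples_def)
  then show ?case using assms(1) App.prems by (auto simp: finite_algebra_def)
qed

lemma Clo_subset_all_functions:
  assumes "finite_algebra \<A>"
  shows "Clo \<A> k \<subseteq> all_functions \<A> k"
  using eval_term_closed[OF assms] by (auto simp: Clo_def all_functions_def)

lemma finite_all_functions:
  assumes "finite_algebra \<A>"
  shows "finite (all_functions \<A> k)"
  unfolding all_functions_def using assms
  by (intro finite_PiE finite_tuples) (auto simp: finite_algebra_def)

lemma finite_Clo: "finite_algebra \<A> \<Longrightarrow> finite (Clo \<A> k)"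
  using Clo_subset_all_functions finite_all_functions finite_subset by blast

lemma Clo_nonempty:
  assumes "1 \<le> k"
  shows "Clo \<A> k \<noteq> {}"
proof -
  have "is_term \<A> k (Var 0)" using assms by simp
  then show ?thesis unfolding Clo_def by blast
qed

lemma Prim_arity_le:
  assumes "finite_algebra \<A>" and "1 \<le> k" and f: "f \<in> all_functions \<A> k"
    and le: "\<And>t. t \<in> Clo \<A> k \<Longrightarrow> coincidence (universe \<A>) k f t \<le> c"
  shows "Prim_arity k \<A> \<le> c"
proof -
  have "Prim_arity k \<A> \<le> Max ((\<lambda>t. coincidence (universe \<A>) k f t) ` Clo \<A> k)"
    unfolding Prim_arity_def using assms(1) f by (intro Min_le) (auto simp: finite_all_functions)
  also have "\<dots> \<le> c"
    using le finite_Clo[OF assms(1)] Clo_nonempty[OF assms(2)] by (intro Max.boundedI) auto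
  finally show ?thesis .
qed

lemma le_Prim_arity:
  assumes "finite_algebra \<A>"
    and ex: "\<And>f. f \<in> all_functions \<A> k \<Longrightarrow> \<exists>t\<in>Clo \<A> k. c \<le> coincidence (universe \<A>) k f t"
  shows "c \<le> Prim_arity k \<A>"
  unfolding Prim_arity_def
proof (intro Min.boundedI)
  show "finite ((\<lambda>f. Max ((\<lambda>t. coincidence (universe \<A>) k f t) ` Clo \<A> k)) ` all_functions \<A> k)"
    using finite_all_functions[OF assms(1)] by simp
  have "universe \<A> \<noteq> {}" using assms(1) by (simp add: finite_algebra_def)
  then show "(\<lambda>f. Max ((\<lambda>t. coincidence (universe \<A>) k f t) ` Clo \<A> k)) ` all_functions \<A> k \<noteq> {}"
    by (simp add: all_functions_def PiE_eq_empty_iff)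
next
  fix r
  assume "r \<in> (\<lambda>f. Max ((\<lambda>t. coincidence (universe \<A>) k f t) ` Clo \<A> k)) ` all_functions \<A> k"
  then obtain f where f: "f \<in> all_functions \<A> k"
    and r: "r = Max ((\<lambda>t. coincidence (universe \<A>) k f t) ` Clo \<A> k)" by auto
  obtain t where "t \<in> Clo \<A> k" "c \<le> coincidence (universe \<A>) k f t" using ex[OF f] by auto
  then show "c \<le> r" unfolding r using finite_Clo[OF assms(1)]
    by (meson Max_ge finite_imageI imageI order_trans)
qed

lemma Prim_le_Prim_arity:
  assumes "finite_algebra \<A>" and "1 \<le> k"
  shows "Prim \<A> \<le> Prim_arity k \<A>"
proof -
  have nonneg: "0 \<le> Prim_arity j \<A>" if "1 \<le> j" for j
    using Clo_nonempty[OF that, of \<A>]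
    by (intro le_Prim_arity[OF assms(1)]) (auto simp: coincidence_def)
  show ?thesis unfolding Prim_def
    using assms(2) nonneg by (intro cINF_lower bdd_belowI[where m = 0]) auto
qed

lemma primal_Prim_ge_1:
  assumes fin: "finite_algebra \<A>" and prim: "primal \<A>"
  shows "1 \<le> Prim \<A>"
  unfolding Prim_def
proof (rule cINF_greatest)
  fix k :: nat assume "k \<in> {1..}"
  have self: "coincidence (universe \<A>) k f f = 1" for f
    using fin by (simp add: coincidence_def card_tuples finite_algebra_def)
  show "1 \<le> Prim_arity k \<A>"
    using prim \<open>k \<in> {1..}\<close> self
    by (intro le_Prim_arity[OF fin]) (metis atLeast_iff order_refl primal_def)
qed auto

text \<open>A pair of distinct unary operations on two points agrees in at most one of them.\<close>

lemma Prim_le_half_if_unary_missing: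
  assumes fin: "finite_algebra \<A>" and card2: "card (universe \<A>) = 2"
    and f: "f \<in> all_functions \<A> 1" "f \<notin> Clo \<A> 1"
  shows "Prim \<A> \<le> 1 / 2"
proof -
  let ?T = "tuples 1 (universe \<A>)"
  have finA: "finite (universe \<A>)" using fin by (simp add: finite_algebra_def)
  have le: "coincidence (universe \<A>) 1 f t \<le> 1 / 2" if t: "t \<in> Clo \<A> 1" for t
  proof -
    have "t \<in> all_functions \<A> 1" using t Clo_subset_all_functions[OF fin] by auto
    moreover have "t \<noteq> f" using t f by auto
    ultimately have "\<exists>xs\<in>?T. f xs \<noteq> t xs"
      using f(1) unfolding all_functions_def by (metis PiE_ext)
    then have "{xs \<in> ?T. f xs = t xs} \<subset> ?T" by auto
    then have "card {xs \<in> ?T. f xs = t xs} < card ?T"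
      using finite_tuples[OF finA] by (rule psubset_card_mono[rotated])
    then have "card {xs \<in> ?T. f xs = t xs} \<le> 1"
      using card_tuples[OF finA, of 1] card2 by simp
    then show ?thesis by (simp add: coincidence_def card2)
  qed
  have "Prim_arity 1 \<A> \<le> 1 / 2" by (rule Prim_arity_le[OF fin _ f(1) le]) auto
  then show ?thesis using Prim_le_Prim_arity[OF fin, of 1] by simp
qed

section \<open>Operations given by terms\<close>

definition term_op :: "('s, 'a) algebra \<Rightarrow> nat \<Rightarrow> ('a list \<Rightarrow> 'a) \<Rightarrow> bool" where
  "term_op \<A> k f \<longleftrightarrow>
     (\<exists>t. is_term \<A> k t \<and> (\<forall>xs\<in>tuples k (universe \<A>). eval_term \<A> t xs = f xs))"

lemma term_op_cong:
  assumes "term_op \<A> k f" and "\<And>xs. xs \<in> tuples k (universe \<A>) \<Longrightarrow> f xs = g xs"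
  shows "term_op \<A> k g"
  using assms unfolding term_op_def by auto

lemma term_op_closed:
  assumes "finite_algebra \<A>" "term_op \<A> k f" "xs \<in> tuples k (universe \<A>)"
  shows "f xs \<in> universe \<A>"
  using assms eval_term_closed unfolding term_op_def by metis

lemma term_op_imp_Clo:
  assumes "f \<in> all_functions \<A> k" and "term_op \<A> k f"
  shows "f \<in> Clo \<A> k"
proof -
  from assms(2) obtain t where t: "is_term \<A> k t"
    and ev: "\<forall>xs\<in>tuples k (universe \<A>). eval_term \<A> t xs = f xs"
    unfolding term_op_def by auto
  have "f = restrict (eval_term \<A> t) (tuples k (universe \<A>))"
    using assms(1) ev
    by (auto simp: all_functions_def restrict_def PiE_def extensional_def fun_eq_iff)
  then show ?thesis using t unfolding Clo_def by auto
qed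

lemma term_op_var: "i < k \<Longrightarrow> term_op \<A> k (\<lambda>xs. xs ! i)"
  unfolding term_op_def by (rule exI[of _ "Var i"]) auto

lemma term_op_interp:
  assumes s: "s \<in> symbols \<A>" and g: "\<And>i. i < arity \<A> s \<Longrightarrow> term_op \<A> k (g i)"
  shows "term_op \<A> k (\<lambda>xs. interp \<A> s (map (\<lambda>i. g i xs) [0..<arity \<A> s]))"
proof -
  from g obtain t where t: "\<And>i. i < arity \<A> s \<Longrightarrow> is_term \<A> k (t i)"
    "\<And>i xs. i < arity \<A> s \<Longrightarrow> xs \<in> tuples k (universe \<A>) \<Longrightarrow> eval_term \<A> (t i) xs = g i xs"
    unfolding term_op_def by metis
  have *: "eval_term \<A> (App s (map t [0..<arity \<A> s])) xs
      = interp \<A> s (map (\<lambda>i. g i xs) [0..<arity \<A> s])"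
    if "xs \<in> tuples k (universe \<A>)" for xs
    using t(2) that by (auto intro!: arg_cong[where f = "interp \<A> s"])
  show ?thesis unfolding term_op_def
    using s t(1) * by (intro exI[of _ "App s (map t [0..<arity \<A> s])"]) auto
qed

fun subst_term :: "(nat \<Rightarrow> 's op_term) \<Rightarrow> 's op_term \<Rightarrow> 's op_term" where
  "subst_term \<sigma> (Var i) = \<sigma> i"
| "subst_term \<sigma> (App s ts) = App s (map (subst_term \<sigma>) ts)"

lemma is_term_subst:
  "is_term \<A> m t \<Longrightarrow> (\<And>i. i < m \<Longrightarrow> is_term \<A> k (\<sigma> i)) \<Longrightarrow> is_term \<A> k (subst_term \<sigma> t)"
  by (induction t) auto

lemma eval_term_subst:
  "is_term \<A> m t \<Longrightarrow>
   eval_term \<A> (subst_term \<sigma> t) xs = eval_term \<A> t (map (\<lambda>i. eval_term \<A> (\<sigma> i) xs) [0..<m])"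
proof (induction t)
  case (App s ts)
  then have "map (\<lambda>t. eval_term \<A> (subst_term \<sigma> t) xs) ts
      = map (\<lambda>t. eval_term \<A> t (map (\<lambda>i. eval_term \<A> (\<sigma> i) xs) [0..<m])) ts"
    by auto
  then show ?case by (simp add: comp_def del: map_eq_conv)
qed auto

lemma term_op_unary:
  assumes fin: "finite_algebra \<A>"
    and full: "all_functions \<A> 1 \<subseteq> Clo \<A> 1"
    and u: "\<And>a. a \<in> universe \<A> \<Longrightarrow> u a \<in> universe \<A>"
    and g: "term_op \<A> k g"
  shows "term_op \<A> k (\<lambda>xs. u (g xs))"
proof -
  let ?f = "restrict (\<lambda>xs. u (xs ! 0)) (tuples 1 (universe \<A>))"
  have "?f \<in> all_functions \<A> 1"
    using u by (auto simp: all_functions_def nth_tuples)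
  then obtain t where t: "is_term \<A> 1 t" "?f = restrict (eval_term \<A> t) (tuples 1 (universe \<A>))"
    using full unfolding Clo_def by blast
  have ev: "eval_term \<A> t [a] = u a" if "a \<in> universe \<A>" for a
    using that fun_cong[OF t(2), of "[a]"] by (simp add: tuples_def)
  from g obtain w where w: "is_term \<A> k w"
    "\<And>xs. xs \<in> tuples k (universe \<A>) \<Longrightarrow> eval_term \<A> w xs = g xs"
    unfolding term_op_def by auto
  have "is_term \<A> k (subst_term (\<lambda>_. w) t)" using is_term_subst[OF t(1)] w(1) by auto
  moreover have "eval_term \<A> (subst_term (\<lambda>_. w) t) xs = u (g xs)"
    if "xs \<in> tuples k (universe \<A>)" for xs
    using eval_term_subst[OF t(1)] w(2)[OF that] ev term_op_closed[OF fin g that] by simp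
  ultimately show ?thesis unfolding term_op_def by blast
qed

section \<open>Conjunction together with all unary operations generates everything\<close>

text \<open>
  Shannon expansion: an operation depending on its first \<open>j + 1\<close> arguments is a case distinction on
  argument \<open>j\<close> between two operations depending on the first \<open>j\<close> only. Keeping the arity \<open>k\<close> fixed
  and counting the relevant arguments instead keeps all operations on the same set of tuples.
\<close>

lemma term_op_of_conj:
  assumes fin: "finite_algebra \<A>" and U: "universe \<A> = {p, q}" "p \<noteq> q"
    and full: "all_functions \<A> 1 \<subseteq> Clo \<A> 1"
    and conj: "\<And>g h. term_op \<A> k g \<Longrightarrow> term_op \<A> k h \<Longrightarrow>
        term_op \<A> k (\<lambda>xs. if g xs = q \<and> h xs = q then q else p)"
    and k: "1 \<le> k"
    and f: "\<And>xs. xs \<in> tuples k (universe \<A>) \<Longrightarrow> f xs \<in> universe \<A>"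
  shows "term_op \<A> k f"
proof -
  let ?neg = "\<lambda>a. if a = q then p else q"
  have neg: "term_op \<A> k (\<lambda>xs. ?neg (g xs))" if "term_op \<A> k g" for g
    using term_op_unary[OF fin full _ that, of ?neg] U by auto
  have ite: "term_op \<A> k (\<lambda>xs. if c xs = q then g xs else h xs)"
    if c: "term_op \<A> k c" and g: "term_op \<A> k g" and h: "term_op \<A> k h" for c g h
  proof (rule term_op_cong)
    \<comment> \<open>\<open>c ? g : h\<close> is \<open>\<not> (\<not> (c \<and> g) \<and> \<not> (\<not> c \<and> h))\<close>.\<close>
    show "term_op \<A> k (\<lambda>xs. ?neg (
        if ?neg (if c xs = q \<and> g xs = q then q else p) = q \<and>
           ?neg (if ?neg (c xs) = q \<and> h xs = q then q else p) = q then q else p))"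
      by (intro neg conj c g h)
  next
    fix xs assume xs: "xs \<in> tuples k (universe \<A>)"
    show "?neg (
        if ?neg (if c xs = q \<and> g xs = q then q else p) = q \<and>
           ?neg (if ?neg (c xs) = q \<and> h xs = q then q else p) = q then q else p)
      = (if c xs = q then g xs else h xs)"
      using term_op_closed[OF fin g xs] term_op_closed[OF fin h xs] U by auto
  qed
  have upd: "xs[j := a] \<in> tuples k {p, q}"
    if "xs \<in> tuples k {p, q}" "a \<in> {p, q}" for xs j a
    using that set_update_subset_insert[of xs j a] by (auto simp: tuples_def)
  have key: "term_op \<A> k g"
    if "j \<le> k"
      and "\<And>xs. xs \<in> tuples k {p, q} \<Longrightarrow> g xs \<in> {p, q}"
      and "\<And>xs ys. xs \<in> tuples k {p, q} \<Longrightarrow> ys \<in> tuples k {p, q} \<Longrightarrow>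
             take j xs = take j ys \<Longrightarrow> g xs = g ys"
    for j g
    using that
  proof (induction j arbitrary: g)
    case 0
    define c where "c = g (replicate k p)"
    have rep: "replicate k p \<in> tuples k {p, q}" by (auto simp: tuples_def)
    have "term_op \<A> k (\<lambda>xs. c)"
      using term_op_unary[OF fin full _ term_op_var[of 0 k \<A>], of "\<lambda>_. c"] k
        "0.prems"(2)[OF rep] U by (auto simp: c_def)
    then show ?case
    proof (rule term_op_cong)
      fix xs assume "xs \<in> tuples k (universe \<A>)"
      then have "xs \<in> tuples k {p, q}" by (simp add: U)
      from "0.prems"(3)[OF rep this] show "c = g xs" by (simp add: c_def)
    qed
  next
    case (Suc j)
    have cof: "term_op \<A> k (\<lambda>xs. g (xs[j := a]))" if a: "a \<in> {p, q}" for a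
    proof (rule Suc.IH)
      show "j \<le> k" using Suc.prems(1) by simp
      show "g (xs[j := a]) \<in> {p, q}" if "xs \<in> tuples k {p, q}" for xs
        using Suc.prems(2)[OF upd[OF that a]] .
      show "g (xs[j := a]) = g (ys[j := a])"
        if xs: "xs \<in> tuples k {p, q}" and ys: "ys \<in> tuples k {p, q}" and eq: "take j xs = take j ys"
        for xs ys
      proof (rule Suc.prems(3)[OF upd[OF xs a] upd[OF ys a]])
        show "take (Suc j) (xs[j := a]) = take (Suc j) (ys[j := a])"
          using xs ys eq Suc.prems(1) by (simp add: tuples_def take_Suc_conv_app_nth)
      qed
    qed
    have "term_op \<A> k (\<lambda>xs. if xs ! j = q then g (xs[j := q]) else g (xs[j := p]))"
      using Suc.prems(1) by (intro ite cof term_op_var) auto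
    then show ?case
    proof (rule term_op_cong)
      fix xs assume "xs \<in> tuples k (universe \<A>)"
      then have "xs ! j \<in> {p, q}" using nth_tuples[of xs k _ j] Suc.prems(1) U by auto
      then show "(if xs ! j = q then g (xs[j := q]) else g (xs[j := p])) = g xs"
        using list_update_id[of xs j] by (metis insert_iff singletonD)
    qed
  qed
  show ?thesis
  proof (rule key[of k f])
    show "f xs \<in> {p, q}" if "xs \<in> tuples k {p, q}" for xs
      using f[of xs] that by (simp add: U)
    show "f xs = f ys"
      if "xs \<in> tuples k {p, q}" "ys \<in> tuples k {p, q}" "take k xs = take k ys" for xs ys
      using that by (simp add: tuples_def)
  qed simp
qed

section \<open>Affine operations\<close>

text \<open>
  On a two-element set this is \<open>a + b + c\<close> modulo \<open>2\<close>. Unlike the binary sum it does not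
  depend on which element is called zero.
\<close>

definition sum3 :: "'a \<Rightarrow> 'a \<Rightarrow> 'a \<Rightarrow> 'a" where
  "sum3 a b c = (if a = b then c else if a = c then b else a)"

definition sum3_list :: "'a list \<Rightarrow> 'a list \<Rightarrow> 'a list \<Rightarrow> 'a list" where
  "sum3_list x y z = map (\<lambda>(a, b, c). sum3 a b c) (zip x (zip y z))"

text \<open>
  Over the two-element field, preserving the sum of three arguments characterises the affine
  operations, and a preservation property passes to compositions for free.
\<close>

definition affine_op :: "'a set \<Rightarrow> nat \<Rightarrow> ('a list \<Rightarrow> 'a) \<Rightarrow> bool" where
  "affine_op A k f \<longleftrightarrow> (\<forall>x\<in>tuples k A. \<forall>y\<in>tuples k A. \<forall>z\<in>tuples k A.
     f (sum3_list x y z) = sum3 (f x) (f y) (f z))"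

lemma sum3_list_simps [simp]:
  "sum3_list [] [] [] = []"
  "sum3_list (a # x) (b # y) (c # z) = sum3 a b c # sum3_list x y z"
  by (simp_all add: sum3_list_def)

lemma sum3_simps [simp]: "sum3 a a b = b" "sum3 a b a = b" "sum3 a b b = a"
  by (auto simp: sum3_def)

lemma sum3_closed: "a \<in> A \<Longrightarrow> b \<in> A \<Longrightarrow> c \<in> A \<Longrightarrow> sum3 a b c \<in> A"
  by (auto simp: sum3_def)

lemma sum3_list_same_right [simp]: "length x = length y \<Longrightarrow> sum3_list x y y = x"
  by (induction x y rule: list_induct2) auto

lemma eval_term_affine:
  assumes fin: "finite_algebra \<A>"
    and aff: "\<And>s. s \<in> symbols \<A> \<Longrightarrow> affine_op (universe \<A>) (arity \<A> s) (interp \<A> s)"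
    and t: "is_term \<A> k t"
  shows "affine_op (universe \<A>) k (eval_term \<A> t)"
  unfolding affine_op_def
proof (intro ballI)
  fix x y z
  assume xyz: "x \<in> tuples k (universe \<A>)" "y \<in> tuples k (universe \<A>)" "z \<in> tuples k (universe \<A>)"
  show "eval_term \<A> t (sum3_list x y z) = sum3 (eval_term \<A> t x) (eval_term \<A> t y) (eval_term \<A> t z)"
    using t
  proof (induction t)
    case (Var i)
    then show ?case using xyz by (simp add: sum3_list_def tuples_def)
  next
    case (App s ts)
    let ?e = "\<lambda>x. map (\<lambda>t. eval_term \<A> t x) ts"
    have "?e w \<in> tuples (arity \<A> s) (universe \<A>)" if "w \<in> tuples k (universe \<A>)" for w
      using eval_term_closed[OF fin that] App.prems by (auto simp: tuples_def)
    note mem = this[OF xyz(1)] this[OF xyz(2)] this[OF xyz(3)]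
    have "?e (sum3_list x y z) = sum3_list (?e x) (?e y) (?e z)"
      using App by (auto simp: sum3_list_def intro!: nth_equalityI)
    then show ?case
      using aff[of s] App.prems mem by (simp add: affine_op_def)
  qed
qed

section \<open>Conjunction from an operation that is not affine\<close>

text \<open>
  Modulo \<open>2\<close>, the four vertices \<open>(0,0,0), (1,0,1), (0,1,1), (1,1,0)\<close> of the cube are the sum
  of the three faces \<open>c = 0\<close>, \<open>a = 1\<close> and \<open>b = 1\<close>. A ternary operation that is odd on these
  vertices is therefore odd on one of the faces, where it is a binary operation.
\<close>

lemma odd_face:
  assumes "p \<noteq> q"
    and H: "\<And>a b c. a \<in> {p, q} \<Longrightarrow> b \<in> {p, q} \<Longrightarrow> c \<in> {p, q} \<Longrightarrow> H a b c \<in> {p, q}"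
    and odd: "H q q p \<noteq> sum3 (H p p p) (H q p q) (H p q q)"
  shows "H q q p \<noteq> sum3 (H p p p) (H q p p) (H p q p) \<or>
         H q q q \<noteq> sum3 (H q p p) (H q q p) (H q p q) \<or>
         H q q q \<noteq> sum3 (H p q p) (H q q p) (H p q q)"
proof -
  have "H p p p \<in> {p, q}" "H q p p \<in> {p, q}" "H p q p \<in> {p, q}" "H q q p \<in> {p, q}"
    "H q p q \<in> {p, q}" "H p q q \<in> {p, q}" "H q q q \<in> {p, q}"
    using H by auto
  then show ?thesis using odd \<open>p \<noteq> q\<close> unfolding sum3_def
    by (smt (verit) insert_iff singletonD)
qed

text \<open>
  Suppose \<open>f(x + y + z) \<noteq> f x + f y + f z\<close>. The points \<open>x, y, z, x + y + z\<close> are placed at the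
  vertices \<open>(0,0,0), (1,0,1), (0,1,1), (1,1,0)\<close> of a cube with coordinates \<open>a, b, c\<close>. Along these
  four vertices each coordinate of the point depends on a single one of \<open>a\<close>, \<open>b\<close>, \<open>c\<close>, so that
  constants and negation suffice to substitute it. With only two variables \<open>a, b\<close>, the coordinates
  in which both \<open>y\<close> and \<open>z\<close> differ from \<open>x\<close> would need the sum \<open>a + b\<close>, which is not available;
  the third variable stands in for it.
\<close>

lemma odd_binary_from_non_affine:
  assumes fin: "finite_algebra \<A>" and U: "universe \<A> = {p, q}" "p \<noteq> q"
    and full: "all_functions \<A> 1 \<subseteq> Clo \<A> 1"
    and s: "s \<in> symbols \<A>" and not_affine: "\<not> affine_op (universe \<A>) (arity \<A> s) (interp \<A> s)"
    and k: "1 \<le> k"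
  obtains h where "\<And>a b. a \<in> {p, q} \<Longrightarrow> b \<in> {p, q} \<Longrightarrow> h a b \<in> {p, q}"
    and "h q q \<noteq> sum3 (h p p) (h q p) (h p q)"
    and "\<And>g1 g2. term_op \<A> k g1 \<Longrightarrow> term_op \<A> k g2 \<Longrightarrow> term_op \<A> k (\<lambda>xs. h (g1 xs) (g2 xs))"
proof -
  let ?n = "arity \<A> s"
  let ?f = "interp \<A> s"
  from not_affine obtain x y z where
    x: "x \<in> tuples ?n {p, q}" and y: "y \<in> tuples ?n {p, q}" and z: "z \<in> tuples ?n {p, q}"
    and neq: "?f (sum3_list x y z) \<noteq> sum3 (?f x) (?f y) (?f z)"
    unfolding affine_op_def U by blast
  have len: "length x = ?n" "length y = ?n" "length z = ?n" using x y z by (auto simp: tuples_def)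
  have el: "x ! i \<in> {p, q}" "y ! i \<in> {p, q}" "z ! i \<in> {p, q}" if "i < ?n" for i
    using nth_tuples that x y z by metis+
  define w where "w i a b c =
      (if x ! i = y ! i then (if b = p then x ! i else z ! i)
       else if x ! i = z ! i then (if a = p then x ! i else y ! i)
       else (if c = p then x ! i else y ! i))" for i a b c
  have w_closed: "w i a b c \<in> {p, q}" if "i < ?n" for i a b c
    using el[OF that] by (auto simp: w_def)
  define H where "H a b c = ?f (map (\<lambda>i. w i a b c) [0..<?n])" for a b c
  have H_closed: "H a b c \<in> {p, q}" for a b c
  proof -
    have "map (\<lambda>i. w i a b c) [0..<?n] \<in> tuples ?n {p, q}"
      using w_closed by (simp add: tuples_def image_subset_iff)
    then show ?thesis using fin s U unfolding H_def finite_algebra_def by auto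
  qed
  have vertex: "H p p p = ?f x" "H q p q = ?f y" "H p q q = ?f z"
    "H q q p = ?f (sum3_list x y z)"
  proof -
    have "map (\<lambda>i. w i p p p) [0..<?n] = x"
      using len by (auto simp: w_def intro!: nth_equalityI)
    then show "H p p p = ?f x" by (simp add: H_def)
    have "map (\<lambda>i. w i q p q) [0..<?n] = y"
      using len U by (auto simp: w_def intro!: nth_equalityI)
    then show "H q p q = ?f y" by (simp add: H_def)
    have "map (\<lambda>i. w i p q q) [0..<?n] = z"
      using len U el by (auto simp: w_def intro!: nth_equalityI) (metis insert_iff singletonD)+
    then show "H p q q = ?f z" by (simp add: H_def)
    have "map (\<lambda>i. w i q q p) [0..<?n] = sum3_list x y z"
      using len U by (auto simp: w_def sum3_list_def sum3_def intro!: nth_equalityI)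
    then show "H q q p = ?f (sum3_list x y z)" by (simp add: H_def)
  qed
  have unary: "term_op \<A> k (\<lambda>xs. if g xs = p then a else b)"
    if "term_op \<A> k g" "a \<in> {p, q}" "b \<in> {p, q}" for g a b
    using term_op_unary[OF fin full _ that(1), of "\<lambda>v. if v = p then a else b"] that(2,3) U by auto
  have H_term: "term_op \<A> k (\<lambda>xs. H (g1 xs) (g2 xs) (g3 xs))"
    if g: "term_op \<A> k g1" "term_op \<A> k g2" "term_op \<A> k g3" for g1 g2 g3
    unfolding H_def
  proof (rule term_op_interp[OF s])
    fix i assume i: "i < ?n"
    show "term_op \<A> k (\<lambda>xs. w i (g1 xs) (g2 xs) (g3 xs))"
      unfolding w_def using unary g el[OF i] by (cases "x ! i = y ! i"; cases "x ! i = z ! i") simp_all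
  qed
  have const: "term_op \<A> k (\<lambda>_. a)" if "a \<in> {p, q}" for a
    using unary[OF term_op_var[of 0 k \<A>] that that] k by simp
  have odd: "H q q p \<noteq> sum3 (H p p p) (H q p q) (H p q q)" using neq by (simp add: vertex)
  consider "H q q p \<noteq> sum3 (H p p p) (H q p p) (H p q p)"
    | "H q q q \<noteq> sum3 (H q p p) (H q q p) (H q p q)"
    | "H q q q \<noteq> sum3 (H p q p) (H q q p) (H p q q)"
    using odd_face[OF U(2) H_closed odd] by blast
  then show thesis
  proof cases
    case 1
    show thesis by (rule that[of "\<lambda>a b. H a b p"]) (use 1 H_closed H_term const in auto)
  next
    case 2
    show thesis by (rule that[of "\<lambda>a b. H q a b"]) (use 2 H_closed H_term const in auto)
  next
    case 3
    show thesis by (rule that[of "\<lambda>a b. H a q b"]) (use 3 H_closed H_term const in auto)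
  qed
qed

text \<open>
  A binary operation with an odd number of ones takes one of its values exactly once. Conjunction
  does this at \<open>(q, q)\<close>; the unary maps move the exceptional point and value there.
\<close>

lemma conj_from_odd:
  assumes "p \<noteq> q"
    and h: "\<And>a b. a \<in> {p, q} \<Longrightarrow> b \<in> {p, q} \<Longrightarrow> h a b \<in> {p, q}"
    and odd: "h q q \<noteq> sum3 (h p p) (h q p) (h p q)"
  obtains \<alpha> \<beta> \<gamma> where "\<And>a. \<alpha> a \<in> {p, q}" "\<And>a. \<beta> a \<in> {p, q}" "\<And>a. \<gamma> a \<in> {p, q}"
    and "\<And>a b. a \<in> {p, q} \<Longrightarrow> b \<in> {p, q} \<Longrightarrow>
           \<gamma> (h (\<alpha> a) (\<beta> b)) = (if a = q \<and> b = q then q else p)"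
proof -
  have "h p p \<in> {p, q}" "h p q \<in> {p, q}" "h q p \<in> {p, q}" "h q q \<in> {p, q}" using h by auto
  then have "(h p q \<noteq> h p p \<and> h q p \<noteq> h p p \<and> h q q \<noteq> h p p) \<or>
      (h p p \<noteq> h p q \<and> h q p \<noteq> h p q \<and> h q q \<noteq> h p q) \<or>
      (h p p \<noteq> h q p \<and> h p q \<noteq> h q p \<and> h q q \<noteq> h q p) \<or>
      (h p p \<noteq> h q q \<and> h p q \<noteq> h q q \<and> h q p \<noteq> h q q)"
    using odd \<open>p \<noteq> q\<close> unfolding sum3_def by (smt (verit) insert_iff singletonD)
  then obtain a0 b0 where ab0: "a0 \<in> {p, q}" "b0 \<in> {p, q}"
    and unique: "\<And>a b. a \<in> {p, q} \<Longrightarrow> b \<in> {p, q} \<Longrightarrow> h a b = h a0 b0 \<Longrightarrow> a = a0 \<and> b = b0"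
    by (elim disjE) (blast)+
  \<comment> \<open>\<open>sum3 p q\<close> is negation.\<close>
  define \<alpha> where "\<alpha> a = (if a = q then a0 else sum3 p q a0)" for a
  define \<beta> where "\<beta> b = (if b = q then b0 else sum3 p q b0)" for b
  define \<gamma> where "\<gamma> v = (if v = h a0 b0 then q else p)" for v
  have closed: "\<alpha> a \<in> {p, q}" "\<beta> a \<in> {p, q}" "\<gamma> a \<in> {p, q}" for a
    using ab0 by (auto simp: \<alpha>_def \<beta>_def \<gamma>_def sum3_def)
  have exceptional: "\<alpha> a = a0 \<longleftrightarrow> a = q" "\<beta> a = b0 \<longleftrightarrow> a = q" for a
    using ab0 \<open>p \<noteq> q\<close> by (auto simp: \<alpha>_def \<beta>_def sum3_def)
  have "\<gamma> (h (\<alpha> a) (\<beta> b)) = (if a = q \<and> b = q then q else p)" for a b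
  proof (cases "a = q \<and> b = q")
    case True
    then have "\<alpha> a = a0" "\<beta> b = b0" using exceptional by blast+
    then show ?thesis using True by (simp add: \<gamma>_def)
  next
    case False
    then have "h (\<alpha> a) (\<beta> b) \<noteq> h a0 b0"
      using unique[OF closed(1) closed(2), of a b] exceptional by blast
    then show ?thesis using False by (auto simp: \<gamma>_def)
  qed
  then show thesis using that closed by blast
qed

lemma primal_if_not_affine:
  assumes fin: "finite_algebra \<A>" and U: "universe \<A> = {p, q}" "p \<noteq> q"
    and full: "all_functions \<A> 1 \<subseteq> Clo \<A> 1"
    and s: "s \<in> symbols \<A>" and not_affine: "\<not> affine_op (universe \<A>) (arity \<A> s) (interp \<A> s)"
  shows "primal \<A>"
  unfolding primal_def
proof (intro allI impI ballI)
  fix k f assume k: "1 \<le> (k::nat)" and f: "f \<in> all_functions \<A> k"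
  obtain h where h: "\<And>a b. a \<in> {p, q} \<Longrightarrow> b \<in> {p, q} \<Longrightarrow> h a b \<in> {p, q}"
      "h q q \<noteq> sum3 (h p p) (h q p) (h p q)"
    and h_term: "\<And>g1 g2. term_op \<A> k g1 \<Longrightarrow> term_op \<A> k g2 \<Longrightarrow> term_op \<A> k (\<lambda>xs. h (g1 xs) (g2 xs))"
    using odd_binary_from_non_affine[OF fin U full s not_affine k] by blast
  obtain \<alpha> \<beta> \<gamma> where closed: "\<And>a. \<alpha> a \<in> {p, q}" "\<And>a. \<beta> a \<in> {p, q}" "\<And>a. \<gamma> a \<in> {p, q}"
    and and_eq: "\<And>a b. a \<in> {p, q} \<Longrightarrow> b \<in> {p, q} \<Longrightarrow>
           \<gamma> (h (\<alpha> a) (\<beta> b)) = (if a = q \<and> b = q then q else p)"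
    using conj_from_odd[OF U(2) h] by blast
  have conj: "term_op \<A> k (\<lambda>xs. if g1 xs = q \<and> g2 xs = q then q else p)"
    if g: "term_op \<A> k g1" "term_op \<A> k g2" for g1 g2
  proof (rule term_op_cong)
    show "term_op \<A> k (\<lambda>xs. \<gamma> (h (\<alpha> (g1 xs)) (\<beta> (g2 xs))))"
      using closed U
      by (intro term_op_unary[OF fin full, where u = \<gamma>] h_term
          term_op_unary[OF fin full, where u = \<alpha>] term_op_unary[OF fin full, where u = \<beta>] g) auto
    show "\<gamma> (h (\<alpha> (g1 xs)) (\<beta> (g2 xs))) = (if g1 xs = q \<and> g2 xs = q then q else p)"
      if "xs \<in> tuples k (universe \<A>)" for xs
      using and_eq term_op_closed[OF fin g(1) that] term_op_closed[OF fin g(2) that] U by auto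
  qed
  have closed_f: "f xs \<in> universe \<A>" if "xs \<in> tuples k (universe \<A>)" for xs
    using f that unfolding all_functions_def by (rule PiE_mem)
  have "term_op \<A> k f" by (rule term_op_of_conj[OF fin U full conj k closed_f])
  then show "f \<in> Clo \<A> k" by (rule term_op_imp_Clo[OF f])
qed

section \<open>Bent functions are far from affine operations\<close>

text \<open>
  The inner product of the odd-numbered with the even-numbered arguments, with \<open>p\<close> as zero and
  \<open>q\<close> as one. Pairing neighbours makes the recursion peel off one product at a time.
\<close>

fun inner_product :: "'a \<Rightarrow> 'a \<Rightarrow> 'a list \<Rightarrow> 'a" where
  "inner_product p q (a # b # xs) =
     (if a = q \<and> b = q then sum3 p q (inner_product p q xs) else inner_product p q xs)"
| "inner_product p q _ = p"

lemma inner_product_closed: "inner_product p q xs \<in> {p, q}"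
proof (induction p q xs rule: inner_product.induct)
  case (1 p q a b xs)
  then show ?case using sum3_closed[of p "{p, q}" q "inner_product p q xs"]
    by (cases "a = q \<and> b = q") simp_all
qed simp_all

text \<open>The nontrivial character of the two-element group with zero \<open>p\<close>.\<close>

definition sign :: "'a \<Rightarrow> 'a \<Rightarrow> int" where
  "sign p a = (if a = p then 1 else - 1)"

lemma sign_sum3:
  assumes "a \<in> {p, q}" "b \<in> {p, q}" "c \<in> {p, q}"
  shows "sign p (sum3 a b c) = sign p a * sign p b * sign p c"
  using assms by (auto simp: sign_def sum3_def)

text \<open>
  Split off two arguments \<open>a, b\<close>. An affine \<open>t\<close> satisfies
  \<open>t(a,b,x) = t(p,p,x) + t(p,p,0) + t(a,b,0)\<close>, so the sum over \<open>x\<close> factors out and leaves a sum of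
  four signs. Their product is \<open>-1\<close>, because the signs of an affine operation on the square
  multiply to \<open>1\<close> and conjunction flips one of them. So they do not all agree in sign and add up to
  \<open>2\<close> or \<open>-2\<close>: each pair of arguments multiplies the correlation by \<open>2\<close> in absolute value
  while the number of points grows by \<open>4\<close>.
\<close>

lemma bent_correlation:
  assumes "p \<noteq> q"
    and "affine_op {p, q} (2 * n) t"
    and "\<And>xs. xs \<in> tuples (2 * n) {p, q} \<Longrightarrow> t xs \<in> {p, q}"
  shows "\<bar>\<Sum>xs\<in>tuples (2 * n) {p, q}. sign p (inner_product p q xs) * sign p (t xs)\<bar> \<le> 2 ^ n"
  using assms(2,3)
proof (induction n arbitrary: t)
  case 0
  show ?case by (simp add: sign_def)
next
  case (Suc n)
  let ?T = "tuples (2 * n) {p, q}"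
  let ?o = "replicate (2 * n) p"
  let ?c = "\<lambda>a b. sign p (t (a # b # ?o))"
  let ?S = "\<Sum>xs\<in>?T. sign p (inner_product p q xs) * sign p (t (p # p # xs))"
  have o: "?o \<in> ?T" by (auto simp: tuples_def)
  have aff: "t (sum3_list x y z) = sum3 (t x) (t y) (t z)"
    if "x \<in> tuples (Suc (Suc (2 * n))) {p, q}" "y \<in> tuples (Suc (Suc (2 * n))) {p, q}"
      "z \<in> tuples (Suc (Suc (2 * n))) {p, q}" for x y z
    using Suc.prems(1) that by (simp add: affine_op_def)
  have closed: "t (a # b # xs) \<in> {p, q}" if "a \<in> {p, q}" "b \<in> {p, q}" "xs \<in> ?T" for a b xs
    using Suc.prems(2)[of "a # b # xs"] that by simp
  have "affine_op {p, q} (2 * n) (\<lambda>xs. t (p # p # xs))"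
    unfolding affine_op_def
  proof (intro ballI)
    fix x y z assume "x \<in> ?T" "y \<in> ?T" "z \<in> ?T"
    then show "t (p # p # sum3_list x y z) = sum3 (t (p # p # x)) (t (p # p # y)) (t (p # p # z))"
      using aff[of "p # p # x" "p # p # y" "p # p # z"] by simp
  qed
  then have IH: "\<bar>?S\<bar> \<le> 2 ^ n" by (rule Suc.IH) (rule closed; simp)
  have split: "sign p (t (a # b # xs)) = sign p (t (p # p # xs)) * ?c p p * ?c a b"
    if ab: "a \<in> {p, q}" "b \<in> {p, q}" and xs: "xs \<in> ?T" for a b xs
  proof -
    have "length xs = 2 * n" using xs by (simp add: tuples_def)
    then have "a # b # xs = sum3_list (p # p # xs) (p # p # ?o) (a # b # ?o)" by simp
    then have "t (a # b # xs) = sum3 (t (p # p # xs)) (t (p # p # ?o)) (t (a # b # ?o))"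
      using aff[of "p # p # xs" "p # p # ?o" "a # b # ?o"] ab xs o by simp
    then show ?thesis
      using sign_sum3[OF closed[OF _ _ xs] closed[OF _ _ o] closed[OF ab o], of p p p p] by simp
  qed
  have corner: "?c q q = ?c q p * ?c p p * ?c p q"
  proof -
    have "q # q # ?o = sum3_list (q # p # ?o) (p # p # ?o) (p # q # ?o)" by simp
    then have "t (q # q # ?o) = sum3 (t (q # p # ?o)) (t (p # p # ?o)) (t (p # q # ?o))"
      using aff[of "q # p # ?o" "p # p # ?o" "p # q # ?o"] o by simp
    then show ?thesis
      using sign_sum3[OF closed[OF _ _ o] closed[OF _ _ o] closed[OF _ _ o], of q p p p p q] by simp
  qed
  have part: "(\<Sum>xs\<in>?T. sign p (inner_product p q (a # b # xs)) * sign p (t (a # b # xs)))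
      = (if a = q \<and> b = q then - 1 else 1) * ?c p p * ?c a b * ?S"
    if ab: "a \<in> {p, q}" "b \<in> {p, q}" for a b
  proof -
    have "sign p (sum3 p q (inner_product p q xs)) = - sign p (inner_product p q xs)" for xs
      using sign_sum3[of p p q q] inner_product_closed[of p q xs] \<open>p \<noteq> q\<close>
      by (auto simp: sign_def sum3_def)
    then show ?thesis
      unfolding sum_distrib_left using split[OF ab] by (intro sum.cong) (auto simp: ac_simps)
  qed
  have "(\<Sum>xs\<in>tuples (2 * Suc n) {p, q}. sign p (inner_product p q xs) * sign p (t xs))
      = ?c p p * (?c p p + ?c p q + ?c q p - ?c q q) * ?S"
    using \<open>p \<noteq> q\<close> part by (simp add: sum_tuples_Suc algebra_simps del: inner_product.simps)
  moreover have "\<bar>?c p p * (?c p p + ?c p q + ?c q p - ?c q q)\<bar> = 2"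
    unfolding corner by (simp add: sign_def)
  ultimately show ?case using IH by (simp add: abs_mult)
qed

lemma Prim_le_half_if_affine:
  assumes fin: "finite_algebra \<A>" and U: "universe \<A> = {p, q}" "p \<noteq> q"
    and aff: "\<And>s. s \<in> symbols \<A> \<Longrightarrow> affine_op (universe \<A>) (arity \<A> s) (interp \<A> s)"
  shows "Prim \<A> \<le> 1 / 2"
proof -
  have bound: "Prim \<A> \<le> 1 / 2 + (1 / 2) * (1 / 2) ^ n" if n: "1 \<le> n" for n
  proof -
    let ?k = "2 * n"
    let ?T = "tuples ?k {p, q}"
    let ?f = "restrict (inner_product p q) ?T"
    have finT: "finite ?T" by (simp add: finite_tuples)
    have cardT: "card ?T = 2 ^ ?k" using U(2) by (simp add: card_tuples flip: numeral_2_eq_2)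
    have f: "?f \<in> all_functions \<A> ?k"
      unfolding all_functions_def U using inner_product_closed by fastforce
    have "coincidence (universe \<A>) ?k ?f g \<le> 1 / 2 + (1 / 2) * (1 / 2) ^ n" if "g \<in> Clo \<A> ?k" for g
    proof -
      from that obtain t where t: "is_term \<A> ?k t" and g: "g = restrict (eval_term \<A> t) ?T"
        unfolding Clo_def U by auto
      have closed: "eval_term \<A> t xs \<in> {p, q}" if "xs \<in> ?T" for xs
        using eval_term_closed[OF fin _ t] that U by auto
      let ?E = "{xs \<in> ?T. inner_product p q xs = eval_term \<A> t xs}"
      have "(\<Sum>xs\<in>?T. sign p (inner_product p q xs) * sign p (eval_term \<A> t xs))
          = (\<Sum>xs\<in>?T. 2 * (if xs \<in> ?E then 1 else 0) - 1)"
      proof (rule sum.cong)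
        fix xs assume xs: "xs \<in> ?T"
        show "sign p (inner_product p q xs) * sign p (eval_term \<A> t xs)
            = 2 * (if xs \<in> ?E then 1 else 0) - 1"
          using closed[OF xs] inner_product_closed[of p q xs] xs U(2) by (auto simp: sign_def)
      qed simp
      also have "\<dots> = 2 * int (card ?E) - 2 ^ ?k"
      proof -
        have "(\<Sum>xs\<in>?T. if xs \<in> ?E then 1 else 0) = int (card (?T \<inter> ?E))"
          using finT by (simp add: sum.If_cases Int_def)
        moreover have "?T \<inter> ?E = ?E" by auto
        ultimately show ?thesis
          using cardT by (simp add: sum_subtractf flip: sum_distrib_left)
      qed
      finally have corr: "(\<Sum>xs\<in>?T. sign p (inner_product p q xs) * sign p (eval_term \<A> t xs))
          = 2 * int (card ?E) - 2 ^ ?k" .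
      have affine: "affine_op {p, q} ?k (eval_term \<A> t)"
        using eval_term_affine[OF fin aff t] U by simp
      have "\<bar>2 * int (card ?E) - 2 ^ ?k\<bar> \<le> 2 ^ n"
        unfolding corr[symmetric] using U(2) affine closed by (rule bent_correlation)
      then have "2 * int (card ?E) \<le> 2 ^ ?k + 2 ^ n" by linarith
      then have "2 * real (card ?E) \<le> 2 ^ ?k + 2 ^ n"
        by (simp flip: of_int_le_iff[where 'a = real])
      then have half: "real (card ?E) \<le> (2 ^ ?k + 2 ^ n) / 2" by (simp add: mult.commute)
      have same: "{xs \<in> ?T. ?f xs = g xs} = ?E" unfolding g by auto
      have "coincidence (universe \<A>) ?k ?f g = real (card ?E) / 2 ^ ?k"
        unfolding coincidence_def U(1) same using U(2) by simp
      also have "\<dots> \<le> ((2 ^ ?k + 2 ^ n) / 2) / 2 ^ ?k"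
        by (rule divide_right_mono[OF half]) simp
      also have "\<dots> = 1 / 2 + (1 / 2) * (1 / 2) ^ n"
      proof -
        have "(2::real) ^ ?k = 2 ^ n * 2 ^ n" by (simp add: mult_2 power_add)
        then show ?thesis by (simp add: field_simps)
      qed
      finally show ?thesis .
    qed
    then have "Prim_arity ?k \<A> \<le> 1 / 2 + (1 / 2) * (1 / 2) ^ n"
      using n f by (intro Prim_arity_le[OF fin]) auto
    then show ?thesis using Prim_le_Prim_arity[OF fin, of ?k] n by simp
  qed
  have "(\<lambda>n. 1 / 2 + (1 / 2) * (1 / 2) ^ n :: real) \<longlonglongrightarrow> 1 / 2 + (1 / 2) * 0"
    by (intro tendsto_intros LIMSEQ_power_zero) simp
  then have "(\<lambda>n. 1 / 2 + (1 / 2) * (1 / 2) ^ n :: real) \<longlonglongrightarrow> 1 / 2" by simp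
  then show ?thesis by (rule LIMSEQ_le_const) (use bound in blast)
qed

section \<open>The characterisation\<close>

theorem theorem7p1:
  fixes \<A> :: "('s, 'a) algebra"
  assumes "finite_algebra \<A>"
    and "card (universe \<A>) = 2"
  shows "\<not> primal \<A> \<longleftrightarrow> Prim \<A> \<le> 1 / 2"
proof
  assume "Prim \<A> \<le> 1 / 2"
  then show "\<not> primal \<A>" using primal_Prim_ge_1[OF assms(1)] by auto
next
  assume not_primal: "\<not> primal \<A>"
  obtain p q where U: "universe \<A> = {p, q}" "p \<noteq> q" using assms(2) by (auto simp: card_2_iff)
  show "Prim \<A> \<le> 1 / 2"
  proof (cases "all_functions \<A> 1 \<subseteq> Clo \<A> 1")
    case False
    then show ?thesis using Prim_le_half_if_unary_missing[OF assms] by auto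
  next
    case True
    then have "affine_op (universe \<A>) (arity \<A> s) (interp \<A> s)" if "s \<in> symbols \<A>" for s
      using primal_if_not_affine[OF assms(1) U True that] not_primal by auto
    then show ?thesis by (rule Prim_le_half_if_affine[OF assms(1) U])
  qed
qed

end
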